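(* For every two constants $\varepsilon>0$ and $\gamma\in(0,1]$, no polynomial time algorithm achieves a $(1-e^{-\gamma}+\varepsilon)$-approximation for the problem of maximizing a non-negative monotone $\gamma$-weakly DR function $f\colon 2^{\mathcal{N}}\to\mathbb{R}_{\ge0}$ subject to a cardinality constraint $|S|\le k$, in the value oracle model.
   Context: A function $f\colon2^{\mathcal{N}}\to\mathbb{R}$ is $\gamma$-weakly DR if for every two sets $A\subseteq B\subseteq\mathcal{N}$ and element $u\in\mathcal{N}\setminus B$ it holds that $f(u\mid A)\ge\gamma\, f(u\mid B)$, where $f(u\mid S)=f(S\cup\{u\})-f(S)$. In the value oracle model the algorithm accesses $f$ only through queries returning $f(S)$ for sets $S$ of its choice; an $\alpha$-approximation means the (expected) value of the output feasible set is at least $\alpha$ times the optimal value $\max_{|S|\le k}f(S)$ on every instance. *)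

theory Defs
  imports "HOL-Probability.Probability" "HOL-Computational_Algebra.Polynomial"
begin

subsection \<open>Set functions and the optimization problem\<close>

definition marginal :: "('a set \<Rightarrow> real) \<Rightarrow> 'a \<Rightarrow> 'a set \<Rightarrow> real" where
  "marginal f u S = f (S \<union> {u}) - f S"

definition weakly_DR :: "real \<Rightarrow> 'a set \<Rightarrow> ('a set \<Rightarrow> real) \<Rightarrow> bool" where
  "weakly_DR \<gamma> N f \<longleftrightarrow>
     (\<forall>A B u. A \<subseteq> B \<and> B \<subseteq> N \<and> u \<in> N - B \<longrightarrow> marginal f u A \<ge> \<gamma> * marginal f u B)"

definition nonneg_on :: "'a set \<Rightarrow> ('a set \<Rightarrow> real) \<Rightarrow> bool" where
  "nonneg_on N f \<longleftrightarrow> (\<forall>S. S \<subseteq> N \<longrightarrow> 0 \<le> f S)"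

definition monotone_fun_on :: "'a set \<Rightarrow> ('a set \<Rightarrow> real) \<Rightarrow> bool" where
  "monotone_fun_on N f \<longleftrightarrow> (\<forall>A B. A \<subseteq> B \<and> B \<subseteq> N \<longrightarrow> f A \<le> f B)"

definition optimum :: "'a set \<Rightarrow> nat \<Rightarrow> ('a set \<Rightarrow> real) \<Rightarrow> real" where
  "optimum N k f = Max (f ` {S. S \<subseteq> N \<and> card S \<le> k})"


subsection \<open>Randomized algorithms with a value oracle\<close>

text \<open>
  Algorithms are programs for the standard unit-cost real RAM, extended by random choices and
  a value oracle. Integer registers hold addresses, counters and bits, real registers hold
  oracle values. Integers have addition and (truncated) subtraction only, so that unit cost
  does not make integer arithmetic unreasonably powerful. There is no instruction from
  reals to integers: real values influence the control flow only through comparisons.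

  The ground set of size \<open>n\<close> is \<open>{..<n}\<close>. A set is represented by \<open>n\<close> consecutive integer
  registers, whose nonzero entries mark its elements.
\<close>

datatype instr =
    IConst nat nat
  | IAdd nat nat nat
  | ISub nat nat nat
  | ILoad nat nat
  | IStore nat nat
  | IJumpLe nat nat nat
  | IRandom nat nat
  | RConst nat real
  | RAdd nat nat nat
  | RSub nat nat nat
  | RMul nat nat nat
  | RDiv nat nat nat
  | RLoad nat nat
  | RStore nat nat
  | RJumpLe nat nat nat
  | ROfInt nat nat
  | Query nat nat

type_synonym program = "instr list"

record config =
  pc :: nat
  ireg :: "nat \<Rightarrow> nat"
  rreg :: "nat \<Rightarrow> real"

definition set_at :: "nat \<Rightarrow> config \<Rightarrow> nat \<Rightarrow> nat set" where
  "set_at n s a = {i. i < n \<and> ireg s (a + i) \<noteq> 0}"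

definition set_ireg :: "nat \<Rightarrow> nat \<Rightarrow> config \<Rightarrow> config" where
  "set_ireg a v s = s\<lparr>pc := pc s + 1, ireg := (ireg s)(a := v)\<rparr>"

definition set_rreg :: "nat \<Rightarrow> real \<Rightarrow> config \<Rightarrow> config" where
  "set_rreg a v s = s\<lparr>pc := pc s + 1, rreg := (rreg s)(a := v)\<rparr>"

definition jump_if :: "bool \<Rightarrow> nat \<Rightarrow> config \<Rightarrow> config" where
  "jump_if b l s = s\<lparr>pc := if b then l else pc s + 1\<rparr>"

text \<open>
  \<open>IRandom a b\<close> draws uniformly from \<open>{0..m}\<close>, where \<open>m\<close> is the content of integer register \<open>b\<close>;
  a fair coin is the case \<open>m = 1\<close>. Only \<open>Query\<close> depends on \<open>f\<close>.
\<close>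

fun exec :: "nat \<Rightarrow> (nat set \<Rightarrow> real) \<Rightarrow> instr \<Rightarrow> config \<Rightarrow> config pmf" where
  "exec n f (IConst a c) s = return_pmf (set_ireg a c s)"
| "exec n f (IAdd a b c) s = return_pmf (set_ireg a (ireg s b + ireg s c) s)"
| "exec n f (ISub a b c) s = return_pmf (set_ireg a (ireg s b - ireg s c) s)"
| "exec n f (ILoad a b) s = return_pmf (set_ireg a (ireg s (ireg s b)) s)"
| "exec n f (IStore a b) s = return_pmf (set_ireg (ireg s a) (ireg s b) s)"
| "exec n f (IJumpLe a b l) s = return_pmf (jump_if (ireg s a \<le> ireg s b) l s)"
| "exec n f (IRandom a b) s = map_pmf (\<lambda>v. set_ireg a v s) (pmf_of_set {0..ireg s b})"
| "exec n f (RConst a c) s = return_pmf (set_rreg a c s)"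
| "exec n f (RAdd a b c) s = return_pmf (set_rreg a (rreg s b + rreg s c) s)"
| "exec n f (RSub a b c) s = return_pmf (set_rreg a (rreg s b - rreg s c) s)"
| "exec n f (RMul a b c) s = return_pmf (set_rreg a (rreg s b * rreg s c) s)"
| "exec n f (RDiv a b c) s = return_pmf (set_rreg a (rreg s b / rreg s c) s)"
| "exec n f (RLoad a b) s = return_pmf (set_rreg a (rreg s (ireg s b)) s)"
| "exec n f (RStore a b) s = return_pmf (set_rreg (ireg s a) (rreg s b) s)"
| "exec n f (RJumpLe a b l) s = return_pmf (jump_if (rreg s a \<le> rreg s b) l s)"
| "exec n f (ROfInt a b) s = return_pmf (set_rreg a (real (ireg s b)) s)"
| "exec n f (Query a b) s = return_pmf (set_rreg a (f (set_at n s (ireg s b))) s)"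

definition halted :: "program \<Rightarrow> config \<Rightarrow> bool" where
  "halted P s \<longleftrightarrow> length P \<le> pc s"

definition step :: "program \<Rightarrow> nat \<Rightarrow> (nat set \<Rightarrow> real) \<Rightarrow> config \<Rightarrow> config pmf" where
  "step P n f s = (if halted P s then return_pmf s else exec n f (P ! pc s) s)"

primrec run :: "program \<Rightarrow> nat \<Rightarrow> (nat set \<Rightarrow> real) \<Rightarrow> nat \<Rightarrow> config \<Rightarrow> config pmf" where
  "run P n f 0 s = return_pmf s"
| "run P n f (Suc t) s = bind_pmf (step P n f s) (run P n f t)"

text \<open>The input \<open>n\<close>, \<open>k\<close> is placed in the integer registers 0 and 1.\<close>

definition initial :: "nat \<Rightarrow> nat \<Rightarrow> config" where
  "initial n k = \<lparr>pc = 0, ireg = (\<lambda>_. 0)(0 := n, 1 := k), rreg = (\<lambda>_. 0)\<rparr>"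

text \<open>The output is the set stored at the address held by integer register 0.\<close>

definition output_set :: "nat \<Rightarrow> config \<Rightarrow> nat set" where
  "output_set n s = set_at n s (ireg s 0)"

text \<open>
  The time bound is worst-case over the random choices; configurations that have halted do not
  change any more, so the configuration after \<open>poly p n\<close> steps carries the output.
\<close>

definition poly_time_approximation :: "program \<Rightarrow> real \<Rightarrow> real \<Rightarrow> bool" where
  "poly_time_approximation P \<gamma> \<alpha> \<longleftrightarrow>
     (\<exists>p :: nat poly. \<forall>n k f.
        nonneg_on {..<n} f \<and> monotone_fun_on {..<n} f \<and> weakly_DR \<gamma> {..<n} f \<longrightarrow>
        (let D = run P n f (poly p n) (initial n k) in
           (\<forall>s \<in> set_pmf D. halted P s \<and> card (output_set n s) \<le> k) \<and>
           measure_pmf.expectation D (\<lambda>s. f (output_set n s)) \<ge> \<alpha> * optimum {..<n} k f))"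

end

theory Submission
  imports Defs
begin

text \<open>
  Hide a random \<open>k\<close>-set \<open>H\<close> in a ground set of size \<open>n = k ^ 5\<close>. Elements outside \<open>H\<close>, and the
  first \<open>\<tau>\<close> elements of \<open>H\<close>, multiply the distance of \<open>f\<close> to \<open>1\<close> by \<open>1 - \<gamma> / k\<close>. Every further element
  of \<open>H\<close> decreases it by \<open>1 / \<gamma>\<close> times what such a step would gain without these further elements,
  which is exactly the boost that \<open>\<gamma>\<close>-weak diminishing returns permits. Hence \<open>H\<close> has
  value close to \<open>1\<close>, whereas a set meeting \<open>H\<close> in at most \<open>\<tau>\<close> elements has the value that it has for
  \<open>H = {}\<close>, which is about \<open>1 - exp (- \<gamma>)\<close> at size \<open>k\<close>. Truncating \<open>f\<close> makes it constant on sets with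
  at least \<open>k ^ 2 + k\<close> elements, and a smaller set meets a random \<open>H\<close> in more than \<open>\<tau>\<close> elements with
  probability at most \<open>k\<close> to the power \<open>- (\<tau> + 1)\<close>. A large constant \<open>\<tau>\<close> therefore beats the number
  of queries of a polynomial time algorithm.
\<close>

section \<open>Perturbing the oracle\<close>

text \<open>The address of a query is read off the configuration before any oracle value is known,
  so one \<open>S\<close> serves all pairs of oracles at once.\<close>

lemma step_depends_on_one_query:
  "\<exists>S\<subseteq>{..<n}. \<forall>f g. f S = g S \<longrightarrow> step P n f s = step P n g s"
proof -
  have "\<exists>S\<subseteq>{..<n}. \<forall>f g. f S = g S \<longrightarrow> exec n f i s = exec n g i s" for i
  \<comment> \<open>For instructions other than \<open>Query\<close> the set \<open>{}\<close> is a
    dummy.\<close>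
  proof (rule exI[of _ "case i of Query a b \<Rightarrow> set_at n s (ireg s b) | _ \<Rightarrow> {}"])
    show "(case i of Query a b \<Rightarrow> set_at n s (ireg s b) | _ \<Rightarrow> {}) \<subseteq> {..<n} \<and>
        (\<forall>f g. f (case i of Query a b \<Rightarrow> set_at n s (ireg s b) | _ \<Rightarrow> {}) =
           g (case i of Query a b \<Rightarrow> set_at n s (ireg s b) | _ \<Rightarrow> {}) \<longrightarrow> exec n f i s = exec n g i s)"
      by (cases i) (auto simp: set_at_def)
  qed
  then show ?thesis
    unfolding step_def by meson
qed

lemma finite_set_pmf_step: "finite (set_pmf (step P n f s))"
proof -
  have "finite (set_pmf (exec n f i s))" for i
    by (cases i) (auto simp: set_pmf_of_set)
  then show ?thesis
    by (simp add: step_def)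
qed

lemma finite_set_pmf_run: "finite (set_pmf (run P n f t s))"
  by (induction t arbitrary: s) (auto simp: finite_set_pmf_step)

lemma expectation_run_Suc:
  fixes \<phi> :: "config \<Rightarrow> real"
  shows "measure_pmf.expectation (run P n f (Suc t) s) \<phi> =
    measure_pmf.expectation (step P n f s) (\<lambda>s'. measure_pmf.expectation (run P n f t s') \<phi>)"
  by (simp add: pmf_expectation_bind[OF finite_set_pmf_step finite_set_pmf_run order_refl]
      integral_measure_pmf[OF finite_set_pmf_step])

lemma integrable_step: "integrable (measure_pmf (step P n f s)) (\<phi> :: config \<Rightarrow> real)"
  by (rule integrable_measure_pmf_finite[OF finite_set_pmf_step])

lemma integrable_run: "integrable (measure_pmf (run P n f t s)) (\<phi> :: config \<Rightarrow> real)"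
  by (rule integrable_measure_pmf_finite[OF finite_set_pmf_run])

text \<open>
  The expected number of steps of the run with oracle \<open>g\<close> at which answering by \<open>f\<close> would make a
  difference. Only the run with \<open>g\<close> matters, which allows averaging over \<open>f\<close> afterwards.
\<close>

primrec disagreement ::
  "program \<Rightarrow> nat \<Rightarrow> (nat set \<Rightarrow> real) \<Rightarrow> (nat set \<Rightarrow> real) \<Rightarrow> nat \<Rightarrow> config \<Rightarrow> real"
where
  "disagreement P n f g 0 s = 0"
| "disagreement P n f g (Suc t) s =
     of_bool (step P n f s \<noteq> step P n g s) +
     measure_pmf.expectation (step P n g s) (disagreement P n f g t)"

lemma disagreement_nonneg: "0 \<le> disagreement P n f g t s"
  by (induction t arbitrary: s) (auto intro!: add_nonneg_nonneg integral_nonneg)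

text \<open>If the next step is the same under both oracles, the induction hypothesis is averaged
  over it. Otherwise the disagreement is already at least 1, which exceeds any expectation of
  \<open>\<phi>\<close>; so nothing has to be known about the run with \<open>f\<close> after the
  first difference.\<close>

lemma expectation_run_le_disagreement:
  assumes "\<And>s. 0 \<le> \<phi> s" "\<And>s. \<phi> s \<le> 1"
  shows "measure_pmf.expectation (run P n f t s) \<phi> \<le>
    measure_pmf.expectation (run P n g t s) \<phi> + disagreement P n f g t s"
proof (induction t arbitrary: s)
  case 0
  then show ?case by simp
next
  case (Suc t)
  have le_1: "measure_pmf.expectation M \<phi> \<le> 1" for M
    by (rule measure_pmf.integral_le_const) 
       (auto simp: assms intro!: measure_pmf.integrable_const_bound[where B = 1])
  show ?case
  proof (cases "step P n f s = step P n g s")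
    case True
    have "measure_pmf.expectation (run P n f (Suc t) s) \<phi> =
        measure_pmf.expectation (step P n g s) (\<lambda>s'. measure_pmf.expectation (run P n f t s') \<phi>)"
      by (simp only: expectation_run_Suc True)
    also have "\<dots> \<le> measure_pmf.expectation (step P n g s)
        (\<lambda>s'. measure_pmf.expectation (run P n g t s') \<phi> + disagreement P n f g t s')"
      by (intro integral_mono integrable_step Suc.IH)
    also have "\<dots> = measure_pmf.expectation (run P n g (Suc t) s) \<phi> + disagreement P n f g (Suc t) s"
      unfolding expectation_run_Suc by (simp add: Bochner_Integration.integral_add integrable_step True)
    finally show ?thesis .
  next
    case False
    have "0 \<le> measure_pmf.expectation (run P n g (Suc t) s) \<phi>"
      by (intro Bochner_Integration.integral_nonneg assms)
    moreover have "1 \<le> disagreement P n f g (Suc t) s"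
      using False by (simp add: integral_nonneg disagreement_nonneg)
    ultimately show ?thesis
      using le_1[of "run P n f (Suc t) s"] by linarith
  qed
qed

text \<open>All summands follow the same run with \<open>g\<close>, so each configuration tests one
  and the same set against every \<open>f h\<close>, at a cost of at most \<open>c\<close> per
  step.\<close>

lemma sum_disagreement_le:
  assumes "\<And>S. S \<subseteq> {..<n} \<Longrightarrow> (\<Sum>h\<in>I. of_bool (f h S \<noteq> g S)) \<le> (c :: real)"
  shows "(\<Sum>h\<in>I. disagreement P n (f h) g t s) \<le> real t * c"
proof (induction t arbitrary: s)
  case 0
  then show ?case by simp
next
  case (Suc t)
  obtain S where S: "S \<subseteq> {..<n}" "\<forall>f g. f S = g S \<longrightarrow> step P n f s = step P n g s"
    using step_depends_on_one_query[of n P s] by (elim exE conjE)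
  have "(\<Sum>h\<in>I. of_bool (step P n (f h) s \<noteq> step P n g s)) \<le> (\<Sum>h\<in>I. of_bool (f h S \<noteq> g S) :: real)"
  proof (rule sum_mono)
    fix h
    show "of_bool (step P n (f h) s \<noteq> step P n g s) \<le> (of_bool (f h S \<noteq> g S) :: real)"
      using S(2)[rule_format, of "f h" g] by (cases "f h S = g S") simp_all
  qed
  also have "\<dots> \<le> c"
    by (rule assms[OF S(1)])
  finally have now: "(\<Sum>h\<in>I. of_bool (step P n (f h) s \<noteq> step P n g s)) \<le> c" .
  have "(\<Sum>h\<in>I. measure_pmf.expectation (step P n g s) (disagreement P n (f h) g t)) =
      measure_pmf.expectation (step P n g s) (\<lambda>s'. \<Sum>h\<in>I. disagreement P n (f h) g t s')"
    by (simp add: Bochner_Integration.integral_sum integrable_step)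
  also have "\<dots> \<le> real t * c"
    by (intro measure_pmf.integral_le_const integrable_step) (simp add: Suc.IH)
  finally show ?case
    using now by (simp add: sum.distrib algebra_simps)
qed

section \<open>The hard instances\<close>

text \<open>If \<open>f (A \<union> {u})\<close> is at most \<open>c\<close>, the marginal at
  \<open>A\<close> is unchanged and that at \<open>B\<close> can only shrink. Otherwise the step at
  \<open>A\<close> reaches \<open>c\<close> from a lower start, so it gains at least as much as the
  step at \<open>B\<close>.\<close>

lemma truncation:
  assumes "monotone_fun_on N f" "weakly_DR \<gamma> N f" "0 \<le> \<gamma>" "\<gamma> \<le> 1"
  shows "monotone_fun_on N (\<lambda>S. min (f S) c)" "weakly_DR \<gamma> N (\<lambda>S. min (f S) c)"
proof -
  have mono: "f A \<le> f B" if "A \<subseteq> B" "B \<subseteq> N" for A B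
    using assms(1) that by (auto simp: monotone_fun_on_def)
  show "monotone_fun_on N (\<lambda>S. min (f S) c)"
    unfolding monotone_fun_on_def by (meson mono min.mono order_refl)
  show "weakly_DR \<gamma> N (\<lambda>S. min (f S) c)"
    unfolding weakly_DR_def
  proof (intro allI impI)
    fix A B u
    assume *: "A \<subseteq> B \<and> B \<subseteq> N \<and> u \<in> N - B"
    define a a' b b' where defs: "a = f A" "a' = f (A \<union> {u})" "b = f B" "b' = f (B \<union> {u})"
    have le: "a \<le> b" "a \<le> a'" "b \<le> b'" "a' \<le> b'"
      unfolding defs using * by (auto intro!: mono)
    have dr: "\<gamma> * (b' - b) \<le> a' - a"
      using assms(2) * by (auto simp: weakly_DR_def marginal_def defs)
    have nn: "0 \<le> min b' c - min b c"
      using le by auto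
    have shrink: "\<gamma> * (min b' c - min b c) \<le> min b' c - min b c"
      using nn assms(3,4) by (simp add: mult_left_le_one_le)
    have "\<gamma> * (min b' c - min b c) \<le> min a' c - min a c"
    proof (cases "a' \<le> c")
      case True
      have "\<gamma> * (min b' c - min b c) \<le> \<gamma> * (b' - b)"
        using le assms(3) by (intro mult_left_mono) auto
      then show ?thesis using dr True le by auto
    next
      case False
      then show ?thesis using shrink le by (auto simp: min_def split: if_splits)
    qed
    then show "\<gamma> * marginal (\<lambda>S. min (f S) c) u B \<le> marginal (\<lambda>S. min (f S) c) u A"
      by (simp add: marginal_def defs)
  qed
qed

text \<open>
  The truncated subtraction \<open>card (S \<inter> H) - \<tau>\<close> counts the elements of \<open>H\<close> beyond the first \<open>\<tau>\<close>. For
  \<open>H = {}\<close> the functions below depend on \<open>card S\<close> only.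
\<close>

definition residual :: "real \<Rightarrow> nat \<Rightarrow> nat \<Rightarrow> 'a set \<Rightarrow> 'a set \<Rightarrow> real" where
  "residual \<gamma> k \<tau> H S =
     (1 - \<gamma> / k) ^ (card (S - H) + min \<tau> (card (S \<inter> H))) * (1 - real (card (S \<inter> H) - \<tau>) / k)"

definition hard_fun :: "real \<Rightarrow> nat \<Rightarrow> nat \<Rightarrow> 'a set \<Rightarrow> 'a set \<Rightarrow> real" where
  "hard_fun \<gamma> k \<tau> H S = min (1 - residual \<gamma> k \<tau> H S) (1 - (1 - \<gamma> / k) ^ (k * k))"

text \<open>The size of \<open>H\<close> is only bounded above so that the reference oracle
  \<open>H = {}\<close> is covered as well.\<close>

context
  fixes \<gamma> :: real and k \<tau> :: nat and H :: "'a set"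
  assumes \<gamma>: "0 < \<gamma>" "\<gamma> \<le> 1" and k: "0 < k" and H: "finite H" "card H \<le> k"
begin

lemma rate_bounds: "0 \<le> 1 - \<gamma> / k" "1 - \<gamma> / k \<le> 1"
proof -
  have "\<gamma> \<le> real k" using \<gamma> k by linarith
  then show "0 \<le> 1 - \<gamma> / k" "1 - \<gamma> / k \<le> 1" using \<gamma> k by auto
qed

lemma factor_bounds: "0 \<le> 1 - real (card (S \<inter> H) - \<tau>) / k" "1 - real (card (S \<inter> H) - \<tau>) / k \<le> 1"
proof -
  have "card (S \<inter> H) \<le> k" using H by (meson card_mono inf_le2 le_trans)
  then show "0 \<le> 1 - real (card (S \<inter> H) - \<tau>) / k" "1 - real (card (S \<inter> H) - \<tau>) / k \<le> 1"
    using k by auto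
qed

lemma residual_bounds: "0 \<le> residual \<gamma> k \<tau> H S" "residual \<gamma> k \<tau> H S \<le> 1"
  unfolding residual_def using rate_bounds factor_bounds
  by (auto intro!: mult_nonneg_nonneg mult_le_one power_le_one)

lemma residual_antimono:
  assumes "A \<subseteq> B" "finite B"
  shows "residual \<gamma> k \<tau> H B \<le> residual \<gamma> k \<tau> H A"
proof -
  have "card (A - H) \<le> card (B - H)" "card (A \<inter> H) \<le> card (B \<inter> H)"
    using assms by (auto intro!: card_mono)
  then show ?thesis
    unfolding residual_def using rate_bounds factor_bounds k
    by (intro mult_mono power_decreasing) (auto simp: divide_right_mono)
qed

text \<open>In units of the current power over \<open>k\<close>, an element of \<open>H\<close>
  gains \<open>\<gamma>\<close> before the threshold and 1 after it. This jump is the only violation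
  of submodularity.\<close>

lemma residual_diff:
  assumes "finite S" "u \<notin> S"
  shows "residual \<gamma> k \<tau> H S - residual \<gamma> k \<tau> H (insert u S) =
    (if u \<in> H then (if card (S \<inter> H) < \<tau> then \<gamma> else 1) *
         (1 - \<gamma> / k) ^ (card (S - H) + min \<tau> (card (S \<inter> H))) / k
     else \<gamma> * residual \<gamma> k \<tau> H S / k)"
proof (cases "u \<in> H")
  case True
  then have "insert u S - H = S - H" "card (insert u S \<inter> H) = Suc (card (S \<inter> H))"
    using assms by (auto simp: Int_insert_left)
  \<comment> \<open>Strictly below the threshold the truncated subtraction stays 0 even after adding
    \<open>u\<close>, so the linear factor remains 1.\<close>
  moreover have "min \<tau> (Suc i) = Suc i" "Suc i - \<tau> = 0" if "i < \<tau>" for i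
    using that by auto
  ultimately show ?thesis
    using True by (auto simp: residual_def Suc_diff_le min_absorb1 right_diff_distrib algebra_simps
        add_divide_distrib diff_divide_distrib)
next
  case False
  then have "card (insert u S - H) = Suc (card (S - H))" "insert u S \<inter> H = S \<inter> H"
    using assms by (auto simp: insert_Diff_if)
  then show ?thesis
    using False by (auto simp: residual_def algebra_simps)
qed

lemma residual_weakly_DR:
  assumes "finite N"
  shows "weakly_DR \<gamma> N (\<lambda>S. 1 - residual \<gamma> k \<tau> H S)"
  unfolding weakly_DR_def
proof (intro allI impI)
  fix A B u
  assume *: "A \<subseteq> B \<and> B \<subseteq> N \<and> u \<in> N - B"
  then have u: "u \<notin> A" "u \<notin> B" and "A \<subseteq> N" "B \<subseteq> N"
    by auto
  then have fin: "finite A" "finite B"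
    using finite_subset[OF _ assms] by simp_all
  have card: "card (A - H) \<le> card (B - H)" "card (A \<inter> H) \<le> card (B \<inter> H)"
    using * fin by (auto intro!: card_mono)
  define x where "x = (1 - \<gamma> / k) ^ (card (A - H) + min \<tau> (card (A \<inter> H)))"
  define y where "y = (1 - \<gamma> / k) ^ (card (B - H) + min \<tau> (card (B \<inter> H)))"
  have y: "0 \<le> y" "y \<le> x"
    unfolding x_def y_def using rate_bounds card by (auto intro!: power_decreasing)
  have "\<gamma> * (residual \<gamma> k \<tau> H B - residual \<gamma> k \<tau> H (B \<union> {u})) \<le>
      residual \<gamma> k \<tau> H A - residual \<gamma> k \<tau> H (A \<union> {u})"
  proof (cases "u \<in> H")
    case True
    \<comment> \<open>The tight case has only \<open>B\<close> past the threshold; both sides are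
      then \<open>\<gamma>\<close>.\<close>
    have "\<gamma> * (if card (B \<inter> H) < \<tau> then \<gamma> else 1) \<le> (if card (A \<inter> H) < \<tau> then \<gamma> else 1)"
      using card \<gamma> by (auto simp: mult_le_one)
    then have "\<gamma> * (if card (B \<inter> H) < \<tau> then \<gamma> else 1) * y / k \<le>
        (if card (A \<inter> H) < \<tau> then \<gamma> else 1) * x / k"
      using y \<gamma> by (intro divide_right_mono mult_mono) auto
    then show ?thesis
      using True fin u by (simp add: residual_diff x_def y_def mult.assoc)
  next
    case False
    have "\<gamma> * residual \<gamma> k \<tau> H B \<le> residual \<gamma> k \<tau> H B"
      using \<gamma> residual_bounds by (simp add: mult_left_le_one_le)
    also have "\<dots> \<le> residual \<gamma> k \<tau> H A"
      using * fin by (intro residual_antimono) auto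
    finally have "\<gamma> * (\<gamma> * residual \<gamma> k \<tau> H B) / k \<le> \<gamma> * residual \<gamma> k \<tau> H A / k"
      using \<gamma> by (intro divide_right_mono mult_left_mono) auto
    then show ?thesis
      using False fin u by (simp add: residual_diff)
  qed
  then show "\<gamma> * marginal (\<lambda>S. 1 - residual \<gamma> k \<tau> H S) u B \<le> marginal (\<lambda>S. 1 - residual \<gamma> k \<tau> H S) u A"
    by (simp add: marginal_def)
qed

lemma hard_fun_bounds: "0 \<le> hard_fun \<gamma> k \<tau> H S" "hard_fun \<gamma> k \<tau> H S \<le> 1"
  unfolding hard_fun_def using residual_bounds rate_bounds
  by (auto simp: power_le_one min_le_iff_disj)

lemma hard_fun_instance:
  assumes "finite N"
  shows "nonneg_on N (hard_fun \<gamma> k \<tau> H)" "monotone_fun_on N (hard_fun \<gamma> k \<tau> H)"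
    "weakly_DR \<gamma> N (hard_fun \<gamma> k \<tau> H)"
proof -
  have "monotone_fun_on N (\<lambda>S. 1 - residual \<gamma> k \<tau> H S)"
    using assms by (auto simp: monotone_fun_on_def intro!: residual_antimono intro: finite_subset)
  from truncation[OF this residual_weakly_DR[OF assms]] \<gamma>
  show "monotone_fun_on N (hard_fun \<gamma> k \<tau> H)" "weakly_DR \<gamma> N (hard_fun \<gamma> k \<tau> H)"
    by (simp_all add: hard_fun_def[abs_def])
  show "nonneg_on N (hard_fun \<gamma> k \<tau> H)"
    using hard_fun_bounds by (simp add: nonneg_on_def)
qed

text \<open>With at most \<open>\<tau>\<close> elements in \<open>H\<close> the exponent is
  \<open>card S\<close> and the linear factor 1, as for \<open>{}\<close>. With
  \<open>k * k + k\<close> elements, at least \<open>k * k\<close> lie outside \<open>H\<close>, and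
  both functions sit at the cap.\<close>

lemma hard_fun_neq_imp:
  assumes "finite S" "hard_fun \<gamma> k \<tau> H S \<noteq> hard_fun \<gamma> k \<tau> {} S"
  shows "\<tau> < card (S \<inter> H)" "card S < k * k + k"
proof -
  have split: "card (S - H) + card (S \<inter> H) = card S"
    using assms(1) by (metis add.commute card_Diff_subset_Int card_mono finite_Int inf_le1 le_add_diff_inverse)
  show "\<tau> < card (S \<inter> H)"
  proof (rule ccontr)
    assume "\<not> \<tau> < card (S \<inter> H)"
    then have "residual \<gamma> k \<tau> H S = residual \<gamma> k \<tau> {} S"
      using split by (simp add: residual_def)
    then show False using assms(2) by (simp add: hard_fun_def)
  qed
  show "card S < k * k + k"
  proof (rule ccontr)
    assume large: "\<not> card S < k * k + k"
    have "card (S \<inter> H) \<le> k" using H by (meson card_mono inf_le2 le_trans)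
    then have kk: "k * k \<le> card (S - H)" "k * k \<le> card S" using large split by auto
    have "residual \<gamma> k \<tau> H S \<le> (1 - \<gamma> / k) ^ (card (S - H) + min \<tau> (card (S \<inter> H)))"
      unfolding residual_def using rate_bounds factor_bounds by (intro mult_left_le) auto
    also have "\<dots> \<le> (1 - \<gamma> / k) ^ (k * k)"
      using rate_bounds kk by (intro power_decreasing) auto
    finally have "hard_fun \<gamma> k \<tau> H S = 1 - (1 - \<gamma> / k) ^ (k * k)"
      by (simp add: hard_fun_def)
    moreover have "residual \<gamma> k \<tau> {} S \<le> (1 - \<gamma> / k) ^ (k * k)"
      unfolding residual_def using rate_bounds kk by (simp add: power_decreasing)
    ultimately show False using assms(2) by (simp add: hard_fun_def)
  qed
qed

lemma hard_fun_empty_le: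
  assumes "card S \<le> k"
  shows "hard_fun \<gamma> k \<tau> {} S \<le> 1 - (1 - \<gamma> / k) ^ k"
  using power_decreasing[OF assms rate_bounds] by (simp add: hard_fun_def residual_def)

text \<open>The elements past the threshold bring the linear factor down to
  \<open>\<tau> / k\<close>. The other loss comes from the cap; subtracting both bounds the
  minimum.\<close>

lemma hard_fun_self_ge:
  assumes "card H = k" "\<tau> \<le> k"
  shows "1 - \<tau> / k - exp (- \<gamma>) ^ k \<le> hard_fun \<gamma> k \<tau> H H"
proof -
  have "1 - \<gamma> / k \<le> exp (- \<gamma> / k)"
    using exp_ge_add_one_self[of "- \<gamma> / k"] by simp
  then have "(1 - \<gamma> / k) ^ k \<le> exp (- \<gamma> / k) ^ k"
    using rate_bounds by (intro power_mono) auto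
  also have "\<dots> = exp (- \<gamma>)"
    using k by (simp flip: exp_of_nat_mult)
  finally have "((1 - \<gamma> / k) ^ k) ^ k \<le> exp (- \<gamma>) ^ k"
    using rate_bounds by (intro power_mono) auto
  then have 1: "(1 - \<gamma> / k) ^ (k * k) \<le> exp (- \<gamma>) ^ k"
    by (simp add: power_mult)
  have "1 - real (k - \<tau>) / k = \<tau> / k"
    using assms k by (simp add: of_nat_diff field_simps)
  then have "residual \<gamma> k \<tau> H H = (1 - \<gamma> / k) ^ \<tau> * (\<tau> / k)"
    using assms by (simp add: residual_def)
  also have "\<dots> \<le> \<tau> / k"
    using rate_bounds by (intro mult_left_le_one_le) (auto simp: power_le_one)
  finally have 2: "residual \<gamma> k \<tau> H H \<le> \<tau> / k" .
  have "0 \<le> exp (- \<gamma>) ^ k" "0 \<le> \<tau> / k" by auto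
  with 1 2 show ?thesis unfolding hard_fun_def by linarith
qed

end

section \<open>Random hidden sets\<close>

text \<open>Removing \<open>T\<close> is injective on these sets. Equality can fail: for
  \<open>k < card T\<close> the left side is 0, while truncated subtraction makes the right side
  1.\<close>

lemma card_supersets_le:
  assumes "finite N" "T \<subseteq> N"
  shows "card {H. H \<subseteq> N \<and> card H = k \<and> T \<subseteq> H} \<le> (card N - card T) choose (k - card T)"
proof -
  have fin: "finite T" using assms finite_subset by blast
  have "{H. H \<subseteq> N \<and> card H = k \<and> T \<subseteq> H} \<subseteq> (\<lambda>K. K \<union> T) ` {K. K \<subseteq> N - T \<and> card K = k - card T}"
  proof
    fix H assume "H \<in> {H. H \<subseteq> N \<and> card H = k \<and> T \<subseteq> H}"
    then show "H \<in> (\<lambda>K. K \<union> T) ` {K. K \<subseteq> N - T \<and> card K = k - card T}"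
      using fin by (intro image_eqI[of _ _ "H - T"]) (auto simp: card_Diff_subset)
  qed
  then have "card {H. H \<subseteq> N \<and> card H = k \<and> T \<subseteq> H} \<le> card {K. K \<subseteq> N - T \<and> card K = k - card T}"
    using assms by (intro surj_card_le) auto
  also have "\<dots> = (card N - card T) choose (k - card T)"
    using assms fin by (simp add: n_subsets card_Diff_subset)
  finally show ?thesis .
qed

text \<open>Union bound over the \<open>t\<close>-subsets of \<open>S\<close> that \<open>H\<close>
  may contain.\<close>

lemma card_large_intersection_le:
  assumes "finite N" "S \<subseteq> N"
  shows "card {H. H \<subseteq> N \<and> card H = k \<and> t \<le> card (S \<inter> H)} \<le>
    (card S choose t) * ((card N - t) choose (k - t))"
proof -
  have finS: "finite S" using assms finite_subset by blast
  let ?F = "\<lambda>T. {H. H \<subseteq> N \<and> card H = k \<and> T \<subseteq> H}"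
  let ?TT = "{T. T \<subseteq> S \<and> card T = t}"
  have "{H. H \<subseteq> N \<and> card H = k \<and> t \<le> card (S \<inter> H)} \<subseteq> (\<Union>T\<in>?TT. ?F T)"
  proof
    fix H assume H: "H \<in> {H. H \<subseteq> N \<and> card H = k \<and> t \<le> card (S \<inter> H)}"
    then obtain T where "T \<subseteq> S \<inter> H" "card T = t"
      using obtain_subset_with_card_n[of t "S \<inter> H"] by blast
    with H show "H \<in> (\<Union>T\<in>?TT. ?F T)" by blast
  qed
  then have "card {H. H \<subseteq> N \<and> card H = k \<and> t \<le> card (S \<inter> H)} \<le> card (\<Union>T\<in>?TT. ?F T)"
    using assms finS by (intro card_mono finite_UN_I) auto
  also have "\<dots> \<le> (\<Sum>T\<in>?TT. card (?F T))"
    using finS by (intro card_UN_le) auto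
  also have "\<dots> \<le> (\<Sum>T\<in>?TT. (card N - t) choose (k - t))"
  proof (rule sum_mono)
    fix T assume T: "T \<in> ?TT"
    with assms card_supersets_le[of N T k] show "card (?F T) \<le> (card N - t) choose (k - t)"
      by auto
  qed
  also have "\<dots> = (card S choose t) * ((card N - t) choose (k - t))"
    using n_subsets[OF finS] by simp
  finally show ?thesis .
qed

text \<open>Counting pairs of a \<open>k\<close>-set and a \<open>t\<close>-subset of it in two ways
  reduces the claim to a lower bound for \<open>n choose t\<close> and an upper bound for
  \<open>k choose t\<close>.\<close>

lemma binomial_ratio_le:
  assumes "0 < t" "t \<le> k" "k \<le> n"
  shows "real ((n - t) choose (k - t)) \<le> (real (k * t) / n) ^ t * (n choose k)"
proof -
  have "real (n choose t) * ((n - t) choose (k - t)) = (n choose k) * real (k choose t)"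
    using choose_mult[OF assms(2,3)] by (metis of_nat_mult)
  moreover have "(real n / t) ^ t * ((n - t) choose (k - t)) \<le> (n choose t) * real ((n - t) choose (k - t))"
    using binomial_ge_n_over_k_pow_k[of t n, where 'a = real] assms
    by (intro mult_right_mono) auto
  moreover have "(n choose k) * real (k choose t) \<le> (n choose k) * real k ^ t"
    using of_nat_mono[where 'a = real, OF binomial_le_pow[OF assms(2)]]
    by (intro mult_left_mono) auto
  ultimately have "(real n / t) ^ t * ((n - t) choose (k - t)) \<le> (n choose k) * real k ^ t"
    by linarith
  then show ?thesis
    using assms by (simp add: power_divide power_mult_distrib field_simps)
qed

text \<open>There are at most \<open>(2 * k ^ 2) ^ t\<close> choices of a \<open>t\<close>-subset,
  each contained in a fraction \<open>(t / k ^ 4) ^ t\<close> of the \<open>k\<close>-sets. The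
  exponent 5 leaves \<open>2 * t / k ^ 2\<close> as base, at most \<open>1 / k\<close>.\<close>

lemma card_large_intersection_fraction:
  assumes "0 < t" "2 * t \<le> k" and S: "S \<subseteq> {..<k ^ 5}" "card S < k * k + k"
  shows "real (card {H. H \<subseteq> {..<k ^ 5} \<and> card H = k \<and> t \<le> card (S \<inter> H)}) \<le>
    (1 / real k) ^ t * (k ^ 5 choose k)"
proof (cases "t \<le> card S")
  case True
  have k: "0 < k" "k \<le> k ^ 5" using assms self_le_power[of k 5] by auto
  have "card {H. H \<subseteq> {..<k ^ 5} \<and> card H = k \<and> t \<le> card (S \<inter> H)} \<le>
      (card S choose t) * ((k ^ 5 - t) choose (k - t))"
    using card_large_intersection_le[of "{..<k ^ 5}" S k t] S by simp
  then have "real (card {H. H \<subseteq> {..<k ^ 5} \<and> card H = k \<and> t \<le> card (S \<inter> H)}) \<le>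
      real (card S choose t) * ((k ^ 5 - t) choose (k - t))"
    by (simp only: of_nat_le_iff flip: of_nat_mult)
  also have "\<dots> \<le> (2 * real k ^ 2) ^ t * ((real (k * t) / (k ^ 5)) ^ t * (k ^ 5 choose k))"
  proof (intro mult_mono)
    have "card S choose t \<le> card S ^ t" by (rule binomial_le_pow[OF True])
    also have "\<dots> \<le> (2 * k ^ 2) ^ t"
    proof (rule power_mono)
      have "k \<le> k * k" using k by simp
      then show "card S \<le> 2 * k ^ 2" using S(2) unfolding power2_eq_square by linarith
    qed simp
    finally have "real (card S choose t) \<le> real ((2 * k ^ 2) ^ t)"
      by (rule of_nat_mono)
    then show "real (card S choose t) \<le> (2 * real k ^ 2) ^ t"
      by simp
    show "real ((k ^ 5 - t) choose (k - t)) \<le> (real (k * t) / (k ^ 5)) ^ t * (k ^ 5 choose k)"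
      using binomial_ratio_le[of t k "k ^ 5"] assms k by simp
  qed auto
  also have "\<dots> = (2 * real t / real k ^ 2) ^ t * (k ^ 5 choose k)"
  proof -
    have "2 * real k ^ 2 * (real (k * t) / (k ^ 5)) = 2 * real t / real k ^ 2"
      using k by (simp add: field_simps eval_nat_numeral)
    then show ?thesis
      by (simp only: power_mult_distrib[symmetric] mult.assoc[symmetric])
  qed
  also have "\<dots> \<le> (1 / real k) ^ t * (k ^ 5 choose k)"
  proof (intro mult_right_mono power_mono)
    have "2 * real t \<le> real k" using assms(2) by linarith
    then show "2 * real t / real k ^ 2 \<le> 1 / real k"
      using k by (simp add: field_simps power2_eq_square)
  qed auto
  finally show ?thesis .
next
  case False
  have "finite S" using S finite_subset by blast
  then have "card (S \<inter> H) < t" for H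
    using False by (meson card_mono inf_le1 le_trans not_le)
  then have "{H. H \<subseteq> {..<k ^ 5} \<and> card H = k \<and> t \<le> card (S \<inter> H)} = {}"
    by (auto simp: not_le)
  then show ?thesis by (simp only: card.empty) simp
qed

section \<open>Growth of the polynomial time bound\<close>

lemma poly_nat_le_power: "\<exists>C d. \<forall>x\<ge>1. poly (p :: nat poly) x \<le> C * x ^ d"
proof (induction p)
  case 0
  then show ?case by auto
next
  case (pCons a p)
  then obtain C d where Cd: "\<And>x. x \<ge> 1 \<Longrightarrow> poly p x \<le> C * x ^ d" by blast
  have "poly (pCons a p) x \<le> (a + C) * x ^ Suc d" if "x \<ge> 1" for x
  proof -
    have "x * poly p x \<le> C * x ^ Suc d"
      using mult_le_mono2[OF Cd[OF that], of x] by (simp add: mult.left_commute)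
    moreover have "a \<le> a * x ^ Suc d"
      using that by simp
    ultimately show ?thesis by (simp only: poly_pCons add_mult_distrib add_mono)
  qed
  then show ?case by blast
qed

section \<open>Averaging over the hidden set\<close>

text \<open>The required value is averaged over all hidden sets, and every run is replaced by the
  run with oracle \<open>f {}\<close>, whose output does not depend on \<open>H\<close>. Each of the
  \<open>T\<close> steps and the final output may tell \<open>H\<close> from \<open>{}\<close> with
  probability at most \<open>(1 / k) ^ Suc \<tau>\<close>, hence the factor
  \<open>T + 1\<close>.\<close>

lemma approximation_ratio_bound:
  assumes \<gamma>: "0 < \<gamma>" "\<gamma> \<le> 1" and \<alpha>: "0 \<le> \<alpha>" and k: "2 * Suc \<tau> \<le> k" and n: "n = k ^ 5"
    and approx: "\<And>f. nonneg_on {..<n} f \<Longrightarrow> monotone_fun_on {..<n} f \<Longrightarrow> weakly_DR \<gamma> {..<n} f \<Longrightarrow>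
        (\<forall>s \<in> set_pmf (run P n f T (initial n k)). card (output_set n s) \<le> k) \<and>
        \<alpha> * optimum {..<n} k f \<le> measure_pmf.expectation (run P n f T (initial n k)) (\<lambda>s. f (output_set n s))"
  shows "\<alpha> * (1 - \<tau> / k - exp (- \<gamma>) ^ k) \<le> 1 - (1 - \<gamma> / k) ^ k + (T + 1) * (1 / real k) ^ Suc \<tau>"
proof -
  define f where "f = (hard_fun \<gamma> k \<tau> :: nat set \<Rightarrow> nat set \<Rightarrow> real)"
  define \<H> where "\<H> = {H. H \<subseteq> {..<n} \<and> card H = k}"
  define \<beta> where "\<beta> = (1 / real k) ^ Suc \<tau>"
  define D where "D = (\<lambda>H. run P n (f H) T (initial n k))"
  define out where "out = output_set n"
  have k0: "0 < k" using k by simp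
  have fin: "finite H" "card H \<le> k" if "H \<in> \<H> \<or> H = {}" for H
    using that by (auto simp: \<H>_def intro: finite_subset)
  have fin\<H>: "finite \<H>" by (simp add: \<H>_def)
  have card\<H>: "card \<H> = n choose k" using n_subsets[of "{..<n}" k] by (simp add: \<H>_def)
  have "k \<le> n" using k0 n self_le_power[of k 5] by simp
  then have pos: "0 < card \<H>" using card\<H> by simp
  have bounds: "0 \<le> f H S" "f H S \<le> 1" if "H \<in> \<H> \<or> H = {}" for H S
    unfolding f_def using hard_fun_bounds[OF \<gamma> k0 fin[OF that]] by auto
  \<comment> \<open>The case \<open>H = {}\<close> matters too: it makes the outputs of the
    reference run feasible.\<close>
  have inst: "(\<forall>s \<in> set_pmf (D H). card (out s) \<le> k) \<and>
      \<alpha> * optimum {..<n} k (f H) \<le> measure_pmf.expectation (D H) (\<lambda>s. f H (out s))"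
    if "H \<in> \<H> \<or> H = {}" for H
    unfolding D_def out_def f_def
    by (intro approx hard_fun_instance[OF \<gamma> k0 fin[OF that]]) auto
  have out: "out s \<subseteq> {..<n}" for s by (auto simp: out_def output_set_def set_at_def)
  have differ: "(\<Sum>H\<in>\<H>. of_bool (f H S \<noteq> f {} S)) \<le> \<beta> * card \<H>" if S: "S \<subseteq> {..<n}" for S
  proof -
    have finS: "finite S" using S finite_subset by blast
    have neq: "Suc \<tau> \<le> card (S \<inter> H) \<and> card S < k * k + k" if "H \<in> \<H>" "f H S \<noteq> f {} S" for H
      using hard_fun_neq_imp[where \<tau> = \<tau>, OF \<gamma> k0 fin[of H] finS] that by (auto simp: f_def)
    have eq: "(\<Sum>H\<in>\<H>. of_bool (f H S \<noteq> f {} S)) = real (card {H\<in>\<H>. f H S \<noteq> f {} S})"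
      using fin\<H> by (simp add: Collect_conj_eq)
    show ?thesis
    proof (cases "card S < k * k + k")
      case True
      have "card {H\<in>\<H>. f H S \<noteq> f {} S} \<le> card {H. H \<subseteq> {..<n} \<and> card H = k \<and> Suc \<tau> \<le> card (S \<inter> H)}"
        using neq by (intro card_mono) (auto simp: \<H>_def)
      also have "real \<dots> \<le> \<beta> * card \<H>"
        unfolding \<beta>_def card\<H> n using S n k True by (intro card_large_intersection_fraction) auto
      finally show ?thesis using eq by simp
    next
      case False
      then have "{H\<in>\<H>. f H S \<noteq> f {} S} = {}" using neq by blast
      then show ?thesis using eq by (simp add: \<beta>_def)
    qed
  qed
  have upper: "(\<Sum>H\<in>\<H>. f H S) \<le> card \<H> * (1 - (1 - \<gamma> / k) ^ k + \<beta>)"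
    if S: "S \<subseteq> {..<n}" "card S \<le> k" for S
  proof -
    have "(\<Sum>H\<in>\<H>. f H S) \<le> (\<Sum>H\<in>\<H>. f {} S + of_bool (f H S \<noteq> f {} S))"
      using bounds by (intro sum_mono) (auto intro: add_increasing)
    also have "\<dots> \<le> card \<H> * f {} S + \<beta> * card \<H>"
      using differ[OF S(1)] by (simp add: sum.distrib)
    also have "\<dots> \<le> card \<H> * (1 - (1 - \<gamma> / k) ^ k) + \<beta> * card \<H>"
      using hard_fun_empty_le[OF \<gamma> k0 fin[of "{}"] S(2)]
      by (intro add_right_mono mult_left_mono) (auto simp: f_def)
    finally show ?thesis by (simp add: algebra_simps)
  qed
  have "card \<H> * (\<alpha> * (1 - \<tau> / k - exp (- \<gamma>) ^ k)) \<le>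
      (\<Sum>H\<in>\<H>. measure_pmf.expectation (D H) (\<lambda>s. f H (out s)))"
  proof (rule sum_bounded_below)
    fix H assume H: "H \<in> \<H>"
    have "f H H \<le> optimum {..<n} k (f H)"
      unfolding optimum_def using H by (intro Max_ge) (auto simp: \<H>_def)
    moreover have "1 - \<tau> / k - exp (- \<gamma>) ^ k \<le> f H H"
      unfolding f_def using H k by (intro hard_fun_self_ge[OF \<gamma> k0 fin]) (auto simp: \<H>_def)
    ultimately have "\<alpha> * (1 - \<tau> / k - exp (- \<gamma>) ^ k) \<le> \<alpha> * optimum {..<n} k (f H)"
      using \<alpha> by (intro mult_left_mono) auto
    with inst[of H] H
    show "\<alpha> * (1 - \<tau> / k - exp (- \<gamma>) ^ k) \<le> measure_pmf.expectation (D H) (\<lambda>s. f H (out s))"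
      by auto
  qed
  also have "\<dots> \<le> (\<Sum>H\<in>\<H>. measure_pmf.expectation (D {}) (\<lambda>s. f H (out s)) +
      disagreement P n (f H) (f {}) T (initial n k))"
    unfolding D_def using bounds by (intro sum_mono expectation_run_le_disagreement) auto
  also have "\<dots> = measure_pmf.expectation (D {}) (\<lambda>s. \<Sum>H\<in>\<H>. f H (out s)) +
      (\<Sum>H\<in>\<H>. disagreement P n (f H) (f {}) T (initial n k))"
    unfolding D_def by (simp add: sum.distrib Bochner_Integration.integral_sum integrable_run)
  \<comment> \<open>\<open>upper\<close> holds for every feasible set, hence for each possible
    output; the steps are charged through \<open>differ\<close>.\<close>
  also have "\<dots> \<le> card \<H> * (1 - (1 - \<gamma> / k) ^ k + \<beta>) + T * (\<beta> * card \<H>)"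
  proof (intro add_mono sum_disagreement_le differ)
    show "measure_pmf.expectation (D {}) (\<lambda>s. \<Sum>H\<in>\<H>. f H (out s)) \<le>
        card \<H> * (1 - (1 - \<gamma> / k) ^ k + \<beta>)"
      using inst[of "{}"] out upper
      by (intro measure_pmf.integral_le_const) (auto simp: AE_measure_pmf_iff D_def integrable_run)
  qed
  also have "\<dots> = card \<H> * (1 - (1 - \<gamma> / k) ^ k + (T + 1) * \<beta>)"
    by (simp add: algebra_simps)
  finally show ?thesis
    using pos by (simp add: \<beta>_def add.commute)
qed

theorem theorem6:
  fixes \<epsilon> \<gamma> :: real
  assumes "\<epsilon> > 0" and "0 < \<gamma>" and "\<gamma> \<le> 1"
  shows "\<not> (\<exists>P :: program. poly_time_approximation P \<gamma> (1 - exp (- \<gamma>) + \<epsilon>))"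
proof
  define \<alpha> where "\<alpha> = 1 - exp (- \<gamma>) + \<epsilon>"
  assume "\<exists>P :: program. poly_time_approximation P \<gamma> (1 - exp (- \<gamma>) + \<epsilon>)"
  then obtain P and p :: "nat poly" where approx: "\<And>n k f.
      nonneg_on {..<n} f \<Longrightarrow> monotone_fun_on {..<n} f \<Longrightarrow> weakly_DR \<gamma> {..<n} f \<Longrightarrow>
      (\<forall>s \<in> set_pmf (run P n f (poly p n) (initial n k)). card (output_set n s) \<le> k) \<and>
      \<alpha> * optimum {..<n} k f \<le>
        measure_pmf.expectation (run P n f (poly p n) (initial n k)) (\<lambda>s. f (output_set n s))"
    unfolding poly_time_approximation_def \<alpha>_def Let_def by blast
  obtain C d where Cd: "\<And>x. x \<ge> 1 \<Longrightarrow> poly p x \<le> C * x ^ d"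
    using poly_nat_le_power by blast
  \<comment> \<open>On \<open>n = k ^ 5\<close> elements the time is at most
    \<open>C * k ^ (5 * d)\<close>, so \<open>(1 / k) ^ Suc \<tau>\<close> cancels it and leaves a
    factor \<open>1 / k\<close>.\<close>
  define \<tau> where "\<tau> = 5 * d"
  have \<alpha>: "0 \<le> \<alpha>" using assms by (simp add: \<alpha>_def)
  \<comment> \<open>The base is written as \<open>1 + (- \<gamma>) / k\<close> to match the limit of
    the exponential.\<close>
  have bound: "\<alpha> * (1 - \<tau> / k - exp (- \<gamma>) ^ k) \<le> 1 - (1 + (- \<gamma>) / k) ^ k + (C + 1) / k"
    if k: "2 * Suc \<tau> \<le> k" for k
  proof -
    have "poly p (k ^ 5) \<le> C * k ^ \<tau>"
      using Cd[of "k ^ 5"] k by (simp add: \<tau>_def flip: power_mult)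
    moreover have "1 \<le> k ^ \<tau>" using k by simp
    ultimately have "poly p (k ^ 5) + 1 \<le> (C + 1) * k ^ \<tau>" by (simp add: algebra_simps)
    from of_nat_mono[where 'a = real, OF this]
    have "(real (poly p (k ^ 5)) + 1) * (1 / real k) ^ Suc \<tau> \<le>
        (real C + 1) * real k ^ \<tau> * (1 / real k) ^ Suc \<tau>"
      by (intro mult_right_mono) (simp_all add: algebra_simps)
    also have "\<dots> = (C + 1) / k"
      using k by (simp add: power_divide)
    finally show ?thesis
      using approximation_ratio_bound[OF assms(2,3) \<alpha> k refl approx] by simp
  qed
  have "(\<lambda>k. 1 - (1 + (- \<gamma>) / real k) ^ k + (C + 1) / k) \<longlonglongrightarrow> 1 - exp (- \<gamma>) + 0"
    by (intro tendsto_intros tendsto_exp_limit_sequentially lim_const_over_n)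
  moreover have "(\<lambda>k. \<alpha> * (1 - \<tau> / real k - exp (- \<gamma>) ^ k)) \<longlonglongrightarrow> \<alpha> * (1 - 0 - 0)"
    using assms by (intro tendsto_intros lim_const_over_n LIMSEQ_power_zero) auto
  \<comment> \<open>\<open>bound\<close> holds for all large \<open>k\<close>, so it passes to the
    limit and contradicts \<open>\<epsilon> > 0\<close>.\<close>
  ultimately have "\<alpha> * (1 - 0 - 0) \<le> 1 - exp (- \<gamma>) + 0"
    using bound by (intro LIMSEQ_le) blast+
  then show False
    using assms by (simp add: \<alpha>_def)
qed

end
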